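(* Let $B$ be an $n\times n$ complex Hermitian matrix with $\operatorname{sepr}(B)=t_1t_2\cdots t_n$. Then there is no $k\in\{1,\dots,n-1\}$ with $t_kt_{k+1}=\mathtt{A^*N}$, and there is no $k\in\{1,\dots,n-1\}$ with $t_kt_{k+1}=\mathtt{NA^*}$. That is, neither $\mathtt{A^*N}$ nor $\mathtt{NA^*}$ can occur as a subsequence (of consecutive terms) of the sepr-sequence of a Hermitian matrix.
   Context: A principal minor of order $k$ of an $n\times n$ matrix is the determinant of a $k\times k$ principal submatrix (same row and column index set). The signed enhanced principal rank characteristic sequence (sepr-sequence) of an $n\times n$ complex Hermitian matrix $B$ is $\operatorname{sepr}(B)=t_1t_2\cdots t_n$, where: $t_k=\mathtt{A^*}$ if all order-$k$ principal minors are nonzero and there are both a positive and a negative one; $t_k=\mathtt{A^+}$ (resp. $\mathtt{A^-}$) if all order-$k$ principal minors are positive (resp. negative); $t_k=\mathtt{N}$ if all are zero; $t_k=\mathtt{S^*}$ if there are a positive, a negative and a zero order-$k$ principal minor; $t_k=\mathtt{S^+}$ (resp. $\mathtt{S^-}$) if there are both a zero and a nonzero order-$k$ principal minor, and every nonzero one is positive (resp. negative). *)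

theory Defs
  imports
    "Jordan_Normal_Form.Schur_Decomposition"
    "Jordan_Normal_Form.DL_Submatrix"
begin

definition hermitian_mat :: "complex mat \<Rightarrow> bool" where
  "hermitian_mat B \<longleftrightarrow> square_mat B \<and> mat_adjoint B = B"

definition principal_minors :: "complex mat \<Rightarrow> nat \<Rightarrow> complex set" where
  "principal_minors B k =
     {det (submatrix B I I) | I. I \<subseteq> {0..<dim_row B} \<and> card I = k}"

datatype sepr_symbol =
  A_star | A_plus | A_minus | N | S_star | S_plus | S_minus

(* The order on complex numbers is the partial one of Complex_Order: 0 < z means that z is
   real and positive.  Principal minors of a Hermitian matrix are real, so for 1 <= k <= n
   exactly one of the seven conditions holds and the last branch is never reached. *)
definition sepr_term :: "complex mat \<Rightarrow> nat \<Rightarrow> sepr_symbol" where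
  "sepr_term B k = (let M = principal_minors B k in
     if (\<forall>m\<in>M. m \<noteq> 0) \<and> (\<exists>m\<in>M. m > 0) \<and> (\<exists>m\<in>M. m < 0) then A_star
     else if \<forall>m\<in>M. m > 0 then A_plus
     else if \<forall>m\<in>M. m < 0 then A_minus
     else if \<forall>m\<in>M. m = 0 then N
     else if (\<exists>m\<in>M. m > 0) \<and> (\<exists>m\<in>M. m < 0) \<and> (\<exists>m\<in>M. m = 0) then S_star
     else if (\<exists>m\<in>M. m = 0) \<and> (\<exists>m\<in>M. m \<noteq> 0) \<and> (\<forall>m\<in>M. m \<noteq> 0 \<longrightarrow> m > 0) then S_plus
     else if (\<exists>m\<in>M. m = 0) \<and> (\<exists>m\<in>M. m \<noteq> 0) \<and> (\<forall>m\<in>M. m \<noteq> 0 \<longrightarrow> m < 0) then S_minus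
     else undefined)"

(* Lists are 0-indexed: the term t_k is sepr B ! (k - 1). *)
definition sepr :: "complex mat \<Rightarrow> sepr_symbol list" where
  "sepr B = map (sepr_term B) [1..<Suc (dim_row B)]"

end

theory Submission
  imports Defs
begin

text \<open>
  Suppose all principal minors of order \<open>k\<close> are nonzero and both signs occur.  Passing from one
  index set to another by exchanging one index at a time yields a set \<open>L\<close> and indices \<open>p \<noteq> q\<close>
  outside \<open>L\<close> such that the minors of \<open>L \<union> {p}\<close> and \<open>L \<union> {q}\<close> have opposite signs.  Since \<open>B\<close> is
  Hermitian, the Desnanot-Jacobi identity for \<open>L \<union> {p, q}\<close> reads
  \<open>d(L \<union> {p, q}) d(L) = d(L \<union> {p}) d(L \<union> {q}) - |z|^2\<close>, whose right-hand side is negative.  Hence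
  neither the minors of order \<open>k + 1\<close> nor those of order \<open>k - 1\<close> can all vanish.
\<close>

section \<open>Principal minors and the order of enumeration\<close>

text \<open>Rows and columns undergo the same permutation, so its sign enters twice and
  cancels.\<close>

lemma det_reindex_permutes:
  fixes B :: "'a :: comm_ring_1 mat"
  assumes p: "p permutes {0..<m}"
  shows "det (mat m m (\<lambda>(i, j). B $$ (f (p i), f (p j)))) = det (mat m m (\<lambda>(i, j). B $$ (f i, f j)))"
proof -
  let ?A = "mat m m (\<lambda>(i, j). B $$ (f i, f j))"
  let ?R = "mat m m (\<lambda>(i, j). B $$ (f (p i), f j))"
  have lt: "p i < m" if "i < m" for i
    using permutes_in_image[OF p, of i] that by auto
  have R: "det ?R = signof p * det ?A"
    by (subst det_permute_rows[OF _ p, symmetric]) (auto intro!: arg_cong[of _ _ det] eq_matI simp: lt)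
  have "det (mat m m (\<lambda>(i, j). B $$ (f (p i), f (p j)))) = det (transpose_mat (mat m m (\<lambda>(i, j). B $$ (f (p i), f (p j)))))"
    by (subst det_transpose[of _ m]) auto
  also have "\<dots> = det (mat m m (\<lambda>(i, j). (transpose_mat ?R) $$ (p i, j)))"
    by (auto intro!: arg_cong[of _ _ det] eq_matI simp: lt)
  also have "\<dots> = signof p * det (transpose_mat ?R)"
    by (rule det_permute_rows[OF _ p]) auto
  also have "\<dots> = signof p * (signof p * det ?A)"
    unfolding R[symmetric] by (subst det_transpose[of _ m]) auto
  also have "\<dots> = det ?A"
    by (simp add: sign_def)
  finally show ?thesis .
qed

lemma det_reindex:
  fixes B :: "'a :: comm_ring_1 mat"
  assumes f: "bij_betw f {0..<m} I" and g: "bij_betw g {0..<m} I"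
  shows "det (mat m m (\<lambda>(i, j). B $$ (f i, f j))) = det (mat m m (\<lambda>(i, j). B $$ (g i, g j)))"
proof -
  \<comment> \<open>The two enumerations differ by the inverse of \<open>f\<close> composed with
    \<open>g\<close>; the extension by the identity is what \<open>permutes\<close> demands outside
    \<open>{0..<m}\<close>.\<close>
  define p where "p i = (if i \<in> {0..<m} then inv_into {0..<m} f (g i) else i)" for i
  have "bij_betw (inv_into {0..<m} f \<circ> g) {0..<m} {0..<m}"
    by (rule bij_betw_trans[OF g bij_betw_inv_into[OF f]])
  then have "bij_betw p {0..<m} {0..<m}"
    by (rule bij_betw_cong[THEN iffD1, rotated]) (simp add: p_def)
  then have p: "p permutes {0..<m}"
    by (rule bij_imp_permutes) (simp add: p_def)
  have "f (p i) = g i" if "i < m" for i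
    using that g f unfolding p_def by (auto simp: bij_betw_def f_inv_into_f)
  then have "mat m m (\<lambda>(i, j). B $$ (g i, g j)) = mat m m (\<lambda>(i, j). B $$ (f (p i), f (p j)))"
    by (intro eq_matI) auto
  then show ?thesis using det_reindex_permutes[OF p, of B f] by simp
qed

lemma pick_bij_betw:
  assumes "finite I"
  shows "bij_betw (pick I) {0..<card I} I"
proof -
  have inj: "inj_on (pick I) {0..<card I}"
    by (rule inj_onI) (metis pick_mono_le atLeastLessThan_iff nat_neq_iff)
  have "pick I ` {0..<card I} \<subseteq> I" using pick_in_set_le by auto
  then have "pick I ` {0..<card I} = I"
    using assms inj by (intro card_subset_eq) (auto simp: card_image)
  with inj show ?thesis by (simp add: bij_betw_def)
qed

text \<open>\<open>submatrix\<close> lists the indices in increasing order; invariance under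
  reindexing allows any enumeration, so chosen indices can later be put first.\<close>

lemma det_submatrix_enum:
  fixes B :: "'a :: comm_ring_1 mat"
  assumes B: "B \<in> carrier_mat n n" and I: "I \<subseteq> {0..<n}" and f: "bij_betw f {0..<m} I"
  shows "det (submatrix B I I) = det (mat m m (\<lambda>(i, j). B $$ (f i, f j)))"
proof -
  have fin: "finite I" using I finite_subset by blast
  have m: "card I = m" using bij_betw_same_card[OF f] by simp
  have "{i. i < n \<and> i \<in> I} = I" using I by auto
  then have "submatrix B I I = mat m m (\<lambda>(i, j). B $$ (pick I i, pick I j))"
    using B m unfolding submatrix_def by auto
  then show ?thesis using det_reindex[OF pick_bij_betw[OF fin, unfolded m] f, of B] by simp
qed

section \<open>The Desnanot-Jacobi identity\<close>

text \<open>The adjugate of a singular matrix has rank at most one, so its 2x2 minors vanish. This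
  settles the case of the identity in which \<open>det A\<close> cannot be cancelled.\<close>

lemma cofactor_minor_zero:
  fixes A :: "'a :: field mat"
  assumes A: "A \<in> carrier_mat (2 + l) (2 + l)" and det0: "det A = 0"
  shows "cofactor A 0 0 * cofactor A 1 1 - cofactor A 0 1 * cofactor A 1 0 = 0"
\<comment> \<open>If both cofactors in column 0 vanish, each product has a zero factor.\<close>
proof (cases "\<exists>r \<in> {0, 1}. cofactor A r 0 \<noteq> 0")
  case True
  let ?n = "2 + l"
  obtain r where r: "r < 2" "cofactor A r 0 \<noteq> 0" using True that[of 0] that[of 1] by auto
  define C where "C = adj_mat A"
  have C: "C \<in> carrier_mat ?n ?n" and AC: "A * C = 0\<^sub>m ?n ?n"
    using adj_mat[OF A] det0 by (auto simp: C_def)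
  have Cij: "C $$ (i, j) = cofactor A j i" if "i < ?n" "j < ?n" for i j
    using that A by (auto simp: C_def adj_mat_def)
  \<comment> \<open>\<open>v\<close> lies in the kernel of \<open>A\<close> and \<open>v 0 = 0\<close>, so deleting row \<open>r\<close> and column \<open>0\<close> leaves an
    invertible matrix that annihilates the rest of \<open>v\<close>; its entry \<open>v 1\<close> is the claimed expression.\<close>
  define v where "v j = C $$ (0, 0) * C $$ (j, 1) - C $$ (0, 1) * C $$ (j, 0)" for j
  have v0: "v 0 = 0" by (simp add: v_def)
  have Av: "(\<Sum>j<?n. A $$ (i, j) * v j) = 0" if i: "i < ?n" for i
  proof -
    \<comment> \<open>Since \<open>A * C\<close> is zero, every column of the adjugate lies in the
      kernel of \<open>A\<close>, hence so does the combination \<open>v\<close> of two of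
      them.\<close>
    have col: "(\<Sum>j<?n. A $$ (i, j) * C $$ (j, k)) = 0" if k: "k < ?n" for k
    proof -
      have "(A * C) $$ (i, k) = (\<Sum>j<?n. A $$ (i, j) * C $$ (j, k))"
        using A C i k by (simp add: scalar_prod_def atLeast0LessThan)
      then show ?thesis using i k AC by simp
    qed
    have "(\<Sum>j<?n. A $$ (i, j) * v j) = C $$ (0, 0) * (\<Sum>j<?n. A $$ (i, j) * C $$ (j, 1)) -
        C $$ (0, 1) * (\<Sum>j<?n. A $$ (i, j) * C $$ (j, 0))"
      unfolding sum_distrib_left sum_subtractf[symmetric]
      by (rule sum.cong) (auto simp: v_def algebra_simps)
    then show ?thesis by (simp only: col) simp
  qed
  define D where "D = mat_delete A r 0"
  define w where "w = vec (Suc l) (\<lambda>j. v (Suc j))"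
  have D: "D \<in> carrier_mat (Suc l) (Suc l)" using A by (simp add: D_def mat_delete_def)
  have "D *\<^sub>v w = 0\<^sub>v (Suc l)"
  proof (rule eq_vecI)
    fix i assume "i < dim_vec (0\<^sub>v (Suc l))"
    then have i: "i < Suc l" by simp
    let ?i = "if i < r then i else Suc i"
    have "(D *\<^sub>v w) $ i = (\<Sum>j<Suc l. D $$ (i, j) * v (Suc j))"
      using D i by (simp add: scalar_prod_def w_def atLeast0LessThan del: sum.lessThan_Suc)
    also have "\<dots> = (\<Sum>j<Suc l. A $$ (?i, Suc j) * v (Suc j))"
      using A i by (intro sum.cong) (auto simp: D_def mat_delete_def)
    also have "\<dots> = (\<Sum>j<?n. A $$ (?i, j) * v j)"
      by (simp add: sum.lessThan_Suc_shift v0 del: sum.lessThan_Suc)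
    also have "\<dots> = 0" by (rule Av) (use i in auto)
    finally show "(D *\<^sub>v w) $ i = 0\<^sub>v (Suc l) $ i" using i by simp
  qed (use D in auto)
  moreover have "det D \<noteq> 0" using r by (auto simp: cofactor_def D_def)
  moreover have "w \<in> carrier_vec (Suc l)" by (simp add: w_def)
  ultimately have "w = 0\<^sub>v (Suc l)" using det_0_iff_vec_prod_zero[OF D] by blast
  then have "w $ 0 = 0" by simp
  then show ?thesis by (simp add: w_def v_def Cij)
qed auto

lemma det_2x2:
  fixes A :: "'a :: comm_ring_1 mat"
  assumes A: "A \<in> carrier_mat 2 2"
  shows "det A = A $$ (0, 0) * A $$ (1, 1) - A $$ (1, 0) * A $$ (0, 1)"
proof -
  have "cofactor A 0 0 = A $$ (1, 1)" "cofactor A 1 0 = - A $$ (0, 1)"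
    using A by (auto simp: cofactor_def mat_delete_def det_single)
  then show ?thesis
    using laplace_expansion_column[OF A, of 0] by (simp add: numeral_2_eq_2)
qed

text \<open>For invertible \<open>A\<close>, multiplication by \<open>M\<close> turns the first two
  columns into \<open>det A\<close> times unit vectors. Taking determinants yields
  \<open>(det A)\<^sup>2\<close> times the complementary minor, and one factor \<open>det A\<close>
  cancels.\<close>

lemma desnanot_jacobi:
  fixes A :: "'a :: field mat"
  assumes A: "A \<in> carrier_mat (2 + l) (2 + l)"
  shows "det A * det (mat l l (\<lambda>(i, j). A $$ (2 + i, 2 + j))) =
    cofactor A 0 0 * cofactor A 1 1 - cofactor A 0 1 * cofactor A 1 0"
proof (cases "det A = 0")
  case True
  then show ?thesis using cofactor_minor_zero[OF A] by simp
next
  case False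
  let ?n = "2 + l"
  define C where "C = adj_mat A"
  \<comment> \<open>\<open>M\<close> is the identity matrix with its first two columns replaced by those of the adjugate.\<close>
  define C1 where "C1 = mat 2 2 (\<lambda>(i, j). C $$ (i, j))"
  define M where "M = four_block_mat C1 (0\<^sub>m 2 l) (mat l 2 (\<lambda>(i, j). C $$ (2 + i, j))) (1\<^sub>m l)"
  define P where "P = four_block_mat (det A \<cdot>\<^sub>m 1\<^sub>m 2) (mat 2 l (\<lambda>(i, j). A $$ (i, 2 + j)))
    (0\<^sub>m l 2) (mat l l (\<lambda>(i, j). A $$ (2 + i, 2 + j)))"
  have C: "C \<in> carrier_mat ?n ?n" and AC: "A * C = det A \<cdot>\<^sub>m 1\<^sub>m ?n"
    using adj_mat[OF A] by (auto simp: C_def)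
  have Cij: "C $$ (i, j) = cofactor A j i" if "i < ?n" "j < ?n" for i j
    using that A by (auto simp: C_def adj_mat_def)
  have M: "M \<in> carrier_mat ?n ?n"
    unfolding M_def by (rule four_block_carrier_mat) (auto simp: C1_def)
  have SS: "Suc (Suc (x - 2)) = x" if "\<not> x < 2" for x using that by simp
  have "A * M = P"
  proof (rule eq_matI)
    fix i j assume "i < dim_row P" "j < dim_col P"
    then have i: "i < ?n" and j: "j < ?n" by (auto simp: P_def)
    show "(A * M) $$ (i, j) = P $$ (i, j)"
    proof (cases "j < 2")
      case True
      have "col M j = col C j"
        using C j True by (intro eq_vecI) (auto simp: M_def C1_def not_less le_add_diff_inverse simp flip: add_2_eq_Suc)
      then have "(A * M) $$ (i, j) = (A * C) $$ (i, j)" using A M C i j by simp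
      then show ?thesis using i j True by (auto simp: AC P_def)
    next
      case False
      have "col M j = unit_vec ?n j"
        using C j False by (intro eq_vecI) (auto simp: M_def C1_def unit_vec_def)
      then have "(A * M) $$ (i, j) = A $$ (i, j)" using A M i j by simp
      then show ?thesis using i j False SS by (auto simp: P_def)
    qed
  qed (use A M in \<open>auto simp: P_def M_def C1_def\<close>)
  then have "det A * det M = det P" using det_mult[OF A M] by simp
  also have "det M = det C1 * det (1\<^sub>m l)"
    unfolding M_def by (rule det_four_block_mat_upper_right_zero[of _ 2 _ l]) (auto simp: C1_def)
  also have "det P = det (det A \<cdot>\<^sub>m 1\<^sub>m 2 :: 'a mat) * det (mat l l (\<lambda>(i, j). A $$ (2 + i, 2 + j)))"
    unfolding P_def by (rule det_four_block_mat_lower_left_zero[of _ 2 _ l]) auto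
  finally have "det C1 = det A * det (mat l l (\<lambda>(i, j). A $$ (2 + i, 2 + j)))"
    using False by (simp add: det_smult power2_eq_square)
  moreover have "det C1 = cofactor A 0 0 * cofactor A 1 1 - cofactor A 0 1 * cofactor A 1 0"
    by (subst det_2x2) (auto simp: C1_def Cij)
  ultimately show ?thesis by simp
qed

section \<open>Exchanging one index at a time\<close>

text \<open>Swap an element of \<open>I - J\<close> for one of \<open>J - I\<close>. Either
  \<open>P\<close> fails at once and the pair is found, or \<open>P\<close> survives on a set closer
  to \<open>J\<close>, which allows induction on \<open>card (I - J)\<close>.\<close>

lemma exchange_adjacent:
  assumes "finite I" "finite J" "card I = card J" "I \<subseteq> S" "J \<subseteq> S" "P I" "\<not> P J"
  obtains L p q where "L \<subseteq> S" "p \<in> S - L" "q \<in> S - L" "p \<noteq> q" "Suc (card L) = card I"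
    "P (insert p L)" "\<not> P (insert q L)"
proof -
  have "\<exists>L p q. L \<subseteq> S \<and> p \<in> S - L \<and> q \<in> S - L \<and> p \<noteq> q \<and> Suc (card L) = card I \<and>
    P (insert p L) \<and> \<not> P (insert q L)"
    using assms
  proof (induction "card (I - J)" arbitrary: I)
    case 0
    then have "I \<subseteq> J" by auto
    then have "I = J" using 0 card_subset_eq[of J I] by simp
    with 0 show ?case by simp
  next
    case (Suc d)
    then obtain p where p: "p \<in> I - J" by (metis card.empty equals0I nat.distinct(1))
    \<comment> \<open>Equal cardinalities ensure that \<open>J\<close> has an element to swap
      in.\<close>
    have "\<not> J \<subseteq> I" using Suc.prems p card_subset_eq[of I J] by auto
    then obtain q where q: "q \<in> J - I" by auto
    define L where "L = I - {p}"
    have L: "I = insert p L" "p \<notin> L" "q \<notin> L" "p \<noteq> q" "finite L" "Suc (card L) = card I"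
      using p q Suc.prems(1) card.remove[of I p] by (auto simp: L_def)
    show ?case
    proof (cases "P (insert q L)")
      case True
      have "insert q L - J = (I - J) - {p}" using p q by (auto simp: L_def)
      then have "card (insert q L - J) = d" using Suc.hyps(2) p Suc.prems(1) by simp
      moreover have "card (insert q L) = card I" using L by simp
      moreover have "finite (insert q L)" "insert q L \<subseteq> S"
        using L(5) Suc.prems(4,5) q by (auto simp: L_def)
      ultimately show ?thesis
        using Suc.hyps(1)[of "insert q L"] Suc.prems(2,3,5,7) True by simp
    next
      case False
      have "L \<subseteq> S" "p \<in> S - L" "q \<in> S - L"
        using L(2,3) Suc.prems(4,5) p q by (auto simp: L_def)
      with False show ?thesis using L(1,4,6) Suc.prems(6) by metis
    qed
  qed
  with that show ?thesis by blast
qed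

section \<open>Principal minors of Hermitian matrices\<close>

lemma hermitian_mat_index:
  assumes "hermitian_mat B" "B \<in> carrier_mat n n" "i < n" "j < n"
  shows "cnj (B $$ (i, j)) = B $$ (j, i)"
proof -
  have "mat_adjoint B $$ (j, i) = cnj (B $$ (i, j))"
    using assms by (simp add: mat_adjoint_def mat_of_rows_def)
  then show ?thesis using assms by (simp add: hermitian_mat_def)
qed

text \<open>Two matrices are allowed because there are two uses: \<open>A' = A\<close> shows that
  principal minors are real, and distinct submatrices relate the two off-diagonal cofactors.\<close>

lemma cnj_det_transpose:
  assumes "A \<in> carrier_mat m m" "A' \<in> carrier_mat m m"
    and "\<And>i j. i < m \<Longrightarrow> j < m \<Longrightarrow> A' $$ (j, i) = cnj (A $$ (i, j))"
  shows "det A' = cnj (det A)"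
proof -
  interpret cnj: comm_ring_hom cnj by unfold_locales auto
  have "A' = transpose_mat (map_mat cnj A)" using assms by (intro eq_matI) auto
  then show ?thesis using assms(1) by (simp add: det_transpose[of _ m])
qed

lemma principal_minor_real:
  assumes B: "B \<in> carrier_mat n n" "hermitian_mat B" and I: "I \<subseteq> {0..<n}"
  shows "det (submatrix B I I) \<in> \<real>"
proof -
  have fin: "finite I" using I finite_subset by blast
  note pick = pick_bij_betw[OF fin]
  have lt: "pick I i < n" if "i < card I" for i
    using bij_betw_apply[OF pick, of i] that I by auto
  let ?A = "mat (card I) (card I) (\<lambda>(i, j). B $$ (pick I i, pick I j))"
  have "det ?A = cnj (det ?A)"
    by (rule cnj_det_transpose[of _ "card I"]) (auto simp: hermitian_mat_index[OF B(2,1)] lt)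
  then show ?thesis
    unfolding det_submatrix_enum[OF B(1) I pick] by (simp add: Reals_cnj_iff)
qed

text \<open>Enumerate \<open>p\<close> and \<open>q\<close> first, then \<open>L\<close>: deleting
  row and column 0 leaves \<open>insert q L\<close>, deleting row and column 1 leaves
  \<open>insert p L\<close>. The mixed cofactors are conjugate, so their product is
  \<open>z * cnj z\<close>.\<close>

lemma principal_minor_jacobi:
  assumes B: "B \<in> carrier_mat n n" "hermitian_mat B"
    and L: "L \<subseteq> {0..<n}" and p: "p \<in> {0..<n} - L" and q: "q \<in> {0..<n} - L" and "p \<noteq> q"
  defines "d \<equiv> \<lambda>X. det (submatrix B X X)"
  obtains z where "d (insert p (insert q L)) * d L = d (insert p L) * d (insert q L) - z * cnj z"
proof -
  define l where "l = card L"
  define f where "f i = (if i = 0 then p else if i = 1 then q else pick L (i - 2))" for i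
  define A where "A = mat (2 + l) (2 + l) (\<lambda>(i, j). B $$ (f i, f j))"
  have fin: "finite L" using L finite_subset by blast
  have pick: "bij_betw (pick L) {0..<l} L"
    unfolding l_def by (rule pick_bij_betw[OF fin])
  have fL: "bij_betw (\<lambda>i. f (2 + i)) {0..<l} L"
    using pick by (simp add: f_def)
  \<comment> \<open>Prepending a new element to an enumeration.\<close>
  have ext: "bij_betw g {0..<Suc m} (insert x X)"
    if "g 0 = x" "x \<notin> X" "bij_betw (\<lambda>i. g (Suc i)) {0..<m} X" for g :: "nat \<Rightarrow> nat" and x X m
  proof -
    have "{0..<Suc m} = insert 0 (Suc ` {0..<m})"
      by (simp add: atLeast0_lessThan_Suc_eq_insert_0)
    moreover have "bij_betw g (Suc ` {0..<m}) X"
      using that(3) by (auto simp: bij_betw_def inj_on_def image_image simp del: image_Suc_atLeastLessThan)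
    ultimately show ?thesis
      using that(1,2) by (auto simp: bij_betw_def simp del: image_Suc_atLeastLessThan)
  qed
  have fq: "bij_betw (\<lambda>i. f (Suc i)) {0..<Suc l} (insert q L)"
    by (rule ext) (use q fL in \<open>auto simp: f_def\<close>)
  have fpq: "bij_betw f {0..<2 + l} (insert p (insert q L))"
    using ext[OF _ _ fq, of p] p \<open>p \<noteq> q\<close> by (simp add: f_def[of 0])
  \<comment> \<open>Skipping position 1 matches the index shift in
    \<open>mat_delete A 1 1\<close>.\<close>
  have fp: "bij_betw (\<lambda>i. f (if i < 1 then i else Suc i)) {0..<Suc l} (insert p L)"
    by (rule ext) (use p fL in \<open>auto simp: f_def\<close>)
  have A: "A \<in> carrier_mat (2 + l) (2 + l)" by (simp add: A_def)
  have lt: "f i < n" if "i < 2 + l" for i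
    using bij_betw_apply[OF fpq, of i] that L p q by auto
  have "d (insert p (insert q L)) = det A"
    unfolding d_def A_def using L p q by (intro det_submatrix_enum[OF B(1) _ fpq]) auto
  moreover have "d L = det (mat l l (\<lambda>(i, j). A $$ (2 + i, 2 + j)))"
    unfolding d_def using L
    by (subst det_submatrix_enum[OF B(1) _ fL]) (auto simp: A_def intro!: arg_cong[of _ _ det])
  moreover have "d (insert q L) = cofactor A 0 0"
    unfolding d_def using L q
    by (subst det_submatrix_enum[OF B(1) _ fq])
      (auto simp: A_def cofactor_def mat_delete_def intro!: arg_cong[of _ _ det])
  moreover have "d (insert p L) = cofactor A 1 1"
    unfolding d_def using L p
    by (subst det_submatrix_enum[OF B(1) _ fp])
      (auto simp: A_def cofactor_def mat_delete_def intro!: arg_cong[of _ _ det] eq_matI)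
  moreover have "cofactor A 1 0 = cnj (cofactor A 0 1)"
  proof -
    have "det (mat_delete A 1 0) = cnj (det (mat_delete A 0 1))"
      by (rule cnj_det_transpose[of _ "Suc l"])
        (auto simp: A_def mat_delete_def hermitian_mat_index[OF B(2,1)] lt)
    then show ?thesis by (simp add: cofactor_def)
  qed
  ultimately show ?thesis
    using that[of "cofactor A 0 1"] desnanot_jacobi[OF A] by (simp add: mult.commute)
qed

section \<open>Opposite signs at one order\<close>

text \<open>The disjunction \<open>zero\<close> covers both forbidden patterns, since the vanishing
  of either factor on the left of the Jacobi identity gives the same contradiction.\<close>

lemma no_mixed_signs:
  assumes B: "B \<in> carrier_mat n n" "hermitian_mat B"
    and "\<And>m. m \<in> principal_minors B k \<Longrightarrow> m \<noteq> 0"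
    and "\<exists>m\<in>principal_minors B k. m > 0" and "\<exists>m\<in>principal_minors B k. m < 0"
    and zero: "(\<forall>m\<in>principal_minors B (Suc k). m = 0) \<or>
      (\<exists>j. k = Suc j \<and> (\<forall>m\<in>principal_minors B j. m = 0))"
  shows False
proof -
  let ?d = "\<lambda>X. det (submatrix B X X)"
  have mem: "?d X \<in> principal_minors B (card X)" if "X \<subseteq> {0..<n}" for X
    using B(1) that unfolding principal_minors_def by blast
  obtain I J where IJ: "I \<subseteq> {0..<n}" "card I = k" "?d I > 0" "J \<subseteq> {0..<n}" "card J = k" "?d J < 0"
    using assms(4,5) B(1) unfolding principal_minors_def by auto
  have "finite I" "finite J" using IJ finite_subset by blast+
  moreover have "card I = card J" "\<not> ?d J > 0" using IJ by (auto dest: less_asym)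
  ultimately obtain L p q where L: "L \<subseteq> {0..<n}" "p \<in> {0..<n} - L" "q \<in> {0..<n} - L" "p \<noteq> q"
    "Suc (card L) = card I" and pos: "?d (insert p L) > 0" and npos: "\<not> ?d (insert q L) > 0"
    using exchange_adjacent[of I J "{0..<n}" "\<lambda>X. ?d X > 0", OF _ _ _ IJ(1,4,3)] by metis
  have cardL: "Suc (card L) = k" using L(5) IJ(2) by simp
  have fin: "finite L" using L(1) finite_subset by blast
  \<comment> \<open>The order on complex numbers is partial, so failing to be positive means being
    negative only for a minor that is real and nonzero.\<close>
  have "?d (insert q L) \<noteq> 0"
    using mem[of "insert q L"] assms(3) L cardL fin by auto
  moreover have "?d (insert q L) \<in> \<real>"
    using L by (intro principal_minor_real[OF B]) auto
  ultimately have neg: "Re (?d (insert q L)) < 0" "Im (?d (insert q L)) = 0"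
    using npos by (auto simp: less_complex_def complex_is_Real_iff complex_eq_iff)
  obtain z where z: "?d (insert p (insert q L)) * ?d L = ?d (insert p L) * ?d (insert q L) - z * cnj z"
    using principal_minor_jacobi[OF B L(1-4)] by blast
  \<comment> \<open>These index sets have sizes \<open>Suc k\<close> and \<open>k - 1\<close>, one
    for each disjunct of \<open>zero\<close>.\<close>
  have "?d (insert p (insert q L)) = 0 \<or> ?d L = 0"
    using zero mem[of "insert p (insert q L)"] mem[of L] L cardL fin by auto
  then have "?d (insert p L) * ?d (insert q L) = z * cnj z" using z by auto
  then have "Re (?d (insert p L)) * Re (?d (insert q L)) = (Re z)\<^sup>2 + (Im z)\<^sup>2"
    using neg(2) by (auto simp: complex_eq_iff power2_eq_square)
  moreover have "Re (?d (insert p L)) * Re (?d (insert q L)) < 0"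
    using pos neg(1) by (intro mult_pos_neg) (auto simp: less_complex_def)
  ultimately show False by (simp add: add_nonneg_nonneg leD)
qed

section \<open>From symbols to signs of minors\<close>

text \<open>As \<open>undefined\<close> might equal \<open>A_star\<close> or \<open>N\<close>, the last branch of \<^const>\<open>sepr_term\<close> has to be
  excluded, which needs that the minors are real and that there is at least one.\<close>
lemma sepr_term_cases:
  assumes B: "B \<in> carrier_mat n n" "hermitian_mat B" and "k \<le> n"
  shows "sepr_term B k = A_star \<Longrightarrow> (\<forall>m\<in>principal_minors B k. m \<noteq> 0) \<and>
      (\<exists>m\<in>principal_minors B k. m > 0) \<and> (\<exists>m\<in>principal_minors B k. m < 0)"
    and "sepr_term B k = N \<Longrightarrow> \<forall>m\<in>principal_minors B k. m = 0"
proof -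
  define M where "M = principal_minors B k"
  have tri: "m > 0 \<or> m < 0 \<or> m = 0" if "m \<in> M" for m
  proof -
    have "m \<in> \<real>"
      using that B(1) principal_minor_real[OF B] unfolding M_def principal_minors_def by auto
    then show ?thesis by (auto simp: less_complex_def complex_is_Real_iff complex_eq_iff)
  qed
  have "det (submatrix B {0..<k} {0..<k}) \<in> M"
    using assms by (force simp: M_def principal_minors_def)
  then have ne: "M \<noteq> {}" by auto
  define a b c where "a = (\<exists>m\<in>M. m > 0)" and "b = (\<exists>m\<in>M. m < 0)" and "c = (\<exists>m\<in>M. m = 0)"
  \<comment> \<open>By trichotomy each condition is a Boolean combination of \<open>a\<close>,
    \<open>b\<close> and \<open>c\<close>, which leaves a finite case check.\<close>
  have iff: "(\<forall>m\<in>M. m \<noteq> 0) = (\<not> c)" "(\<exists>m\<in>M. m \<noteq> 0) = (a \<or> b)"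
    "(\<forall>m\<in>M. m > 0) = (\<not> b \<and> \<not> c)" "(\<forall>m\<in>M. m < 0) = (\<not> a \<and> \<not> c)"
    "(\<forall>m\<in>M. m = 0) = (\<not> a \<and> \<not> b)"
    "(\<forall>m\<in>M. m \<noteq> 0 \<longrightarrow> m > 0) = (\<not> b)" "(\<forall>m\<in>M. m \<noteq> 0 \<longrightarrow> m < 0) = (\<not> a)"
    unfolding a_def b_def c_def using tri by (metis less_asym less_irrefl)+
  have abc: "a \<or> b \<or> c" using ne tri unfolding a_def b_def c_def by blast
  note term_eq = sepr_term_def[of B k, unfolded Let_def, folded M_def, unfolded iff, folded a_def b_def c_def]
  show "sepr_term B k = A_star \<Longrightarrow> (\<forall>m\<in>principal_minors B k. m \<noteq> 0) \<and>
      (\<exists>m\<in>principal_minors B k. m > 0) \<and> (\<exists>m\<in>principal_minors B k. m < 0)"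
    unfolding M_def[symmetric] iff a_def[symmetric] b_def[symmetric] term_eq
    using abc by (cases a; cases b; cases c) simp_all
  show "sepr_term B k = N \<Longrightarrow> \<forall>m\<in>principal_minors B k. m = 0"
    unfolding M_def[symmetric] iff term_eq
    using abc by (cases a; cases b; cases c) simp_all
qed

theorem theorem3p4:
  fixes B :: "complex mat" and n :: nat
  assumes "B \<in> carrier_mat n n" and "hermitian_mat B"
  shows "\<not> (\<exists>k\<in>{1..n - 1}. sepr B ! (k - 1) = A_star \<and> sepr B ! k = N)
       \<and> \<not> (\<exists>k\<in>{1..n - 1}. sepr B ! (k - 1) = N \<and> sepr B ! k = A_star)"
proof -
  have nth: "sepr B ! j = sepr_term B (Suc j)" if "j < n" for j
    using that assms(1) by (simp add: sepr_def del: upt_Suc)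
  note cases = sepr_term_cases[OF assms] and no_mixed = no_mixed_signs[OF assms]
  have False if k: "k \<in> {1..n - 1}" "sepr B ! (k - 1) = A_star" "sepr B ! k = N" for k
  proof -
    have "sepr_term B k = A_star" "sepr_term B (Suc k) = N" "Suc k \<le> n"
      using k nth[of "k - 1"] nth[of k] by auto
    then show False using cases(1)[of k] cases(2)[of "Suc k"] no_mixed[of k] by auto
  qed
  moreover have False if k: "k \<in> {1..n - 1}" "sepr B ! (k - 1) = N" "sepr B ! k = A_star" for k
  proof -
    have "sepr_term B k = N" "sepr_term B (Suc k) = A_star" "Suc k \<le> n"
      using k nth[of "k - 1"] nth[of k] by auto
    \<comment> \<open>The mixed signs now occur at order \<open>Suc k\<close>, so the second
      disjunct of \<open>no_mixed_signs\<close> applies with \<open>j = k\<close>.\<close>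
    then show False using cases(1)[of "Suc k"] cases(2)[of k] no_mixed[of "Suc k"] by auto
  qed
  ultimately show ?thesis by blast
qed

end
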